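(* Let $A\in\mathbb{R}^{n\times n}$, $B\in\mathbb{R}^{n\times m}$, $C\in\mathbb{R}^{p\times n}$, $D\in\mathbb{R}^{p\times m}$, and let $Q=C^{T}C$, $S=C^{T}D$, $R=D^{T}D$. Let $X=X^{T}\in\mathbb{R}^{n\times n}$ be a solution of CGDARE($\Sigma$), and let $$\mathcal{R}_0=\operatorname{im}\begin{bmatrix}BG_X&A_XBG_X&A_X^2BG_X&\cdots&A_X^{n-1}BG_X\end{bmatrix}$$ be the reachable subspace of the pair $(A_X,BG_X)$. Then $\mathcal{R}^{\star}_{\ker X}=\mathcal{R}_0$, where $\mathcal{R}^{\star}_{\ker X}$ is the reachable subspace on the output-nulling subspace $\ker X$ of the quadruple $(A,B,C,D)$.
   Context: $M^{\dagger}$ denotes the Moore-Penrose pseudo-inverse of $M$. With $\Sigma=(A,B;Q,R,S)$, $X=X^{T}$ is a solution of CGDARE($\Sigma$) if $X=A^{T}XA-(A^{T}XB+S)(R+B^{T}XB)^{\dagger}(B^{T}XA+S^{T})+Q$ and $\ker(R+B^{T}XB)\subseteq\ker(A^{T}XB+S)$. Set $R_X=R+B^{T}XB$, $S_X=A^{T}XB+S$, $K_X=R_X^{\dagger}S_X^{T}$, $A_X=A-BK_X$, $G_X=I_m-R_X^{\dagger}R_X$. The matrices $C,D$ come from a factorisation of the positive semidefinite Popov matrix $\begin{bmatrix}Q&S\\ S^{T}&R\end{bmatrix}=\begin{bmatrix}C^{T}\\ D^{T}\end{bmatrix}\begin{bmatrix}C&D\end{bmatrix}$. A subspace $\mathcal{V}\subseteq\mathbb{R}^n$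 is output-nulling for $(A,B,C,D)$ if $\begin{bmatrix}A\\ C\end{bmatrix}\mathcal{V}\subseteq(\mathcal{V}\oplus 0_p)+\operatorname{im}\begin{bmatrix}B\\ D\end{bmatrix}$, where $0_p$ is the zero subspace of $\mathbb{R}^p$ (for $X$ as in the claim, $\ker X$ is output-nulling). The reachable subspace $\mathcal{R}^{\star}_{\mathcal{V}}$ on an output-nulling subspace $\mathcal{V}$ is the set of points of $\mathcal{V}$ that can be reached from the origin along trajectories contained in $\mathcal{V}$ while maintaining the output at zero: $x\in\mathcal{R}^{\star}_{\mathcal{V}}$ iff there are $N\ge0$ and inputs $u_0,\dots,u_{N-1}$ such that the trajectory $x_{t+1}=Ax_t+Bu_t$ with $x_0=0$ satisfies $x_t\in\mathcal{V}$ for $0\le t\le N$, $Cx_t+Du_t=0$ for $0\le t<N$, and $x_N=x$. *)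

theory Defs
  imports "HOL-Analysis.Analysis" "HOL-Library.Set_Algebras"
begin

definition mker :: "real^'n^'m \<Rightarrow> (real^'n) set" where
  "mker M = {x. M *v x = 0}"

primrec mpow :: "real^'n^'n \<Rightarrow> nat \<Rightarrow> real^'n^'n" where
  "mpow M 0 = mat 1"
| "mpow M (Suc k) = M ** mpow M k"

definition is_pinv :: "real^'n^'m \<Rightarrow> real^'m^'n \<Rightarrow> bool" where
  "is_pinv M G \<longleftrightarrow>
     M ** G ** M = M \<and> G ** M ** G = G \<and>
     transpose (M ** G) = M ** G \<and> transpose (G ** M) = G ** M"

definition pinv :: "real^'n^'m \<Rightarrow> real^'m^'n" where
  "pinv M = (THE G. is_pinv M G)"

lemma is_pinv_unique:
  assumes G: "is_pinv M G" and H: "is_pinv M H"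
  shows "G = H"
proof -
  note g = G[unfolded is_pinv_def] and h = H[unfolded is_pinv_def]
  have "M ** G = transpose (M ** H ** M ** G)"
    using g h by metis
  also have "\<dots> = transpose (M ** G) ** transpose (M ** H)"
    by (simp add: matrix_transpose_mul matrix_mul_assoc)
  also have "\<dots> = (M ** G) ** (M ** H)" using g h by metis
  also have "\<dots> = M ** G ** M ** H" by (simp add: matrix_mul_assoc)
  also have "\<dots> = M ** H" using g by metis
  finally have MG: "M ** G = M ** H" .
  have "G ** M = transpose (G ** (M ** H ** M))"
    using g h by metis
  also have "\<dots> = transpose (H ** M) ** transpose (G ** M)"
    by (simp add: matrix_transpose_mul matrix_mul_assoc)
  also have "\<dots> = (H ** M) ** (G ** M)" using g h by metis
  also have "\<dots> = H ** (M ** G ** M)" by (simp add: matrix_mul_assoc)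
  also have "\<dots> = H ** M" using g by metis
  finally have GM: "G ** M = H ** M" .
  have "G = G ** M ** G" using g by metis
  also have "\<dots> = H ** (M ** G)" by (simp add: GM matrix_mul_assoc)
  also have "\<dots> = H" using h by (simp add: MG matrix_mul_assoc)
  finally show ?thesis .
qed

lemma inner_inverse_exists:
  fixes M :: "real^'n^'m"
  obtains P where "M ** P ** M = M"
proof -
  obtain g where g: "linear g" "\<forall>v\<in>range ((*v) M). M *v g v = v"
    using linear_exists_right_inverse_on[of "(*v) M" UNIV] by auto
  have "M ** matrix g ** M = M"
    unfolding matrix_eq
    using g by (simp add: matrix_works flip: matrix_vector_mul_assoc)
  then show ?thesis using that by blast
qed

lemma gram_cancel:
  fixes M :: "real^'n^'m" and Y Z :: "real^'k^'n"
  assumes "transpose M ** M ** Y = transpose M ** M ** Z"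
  shows "M ** Y = M ** Z"
  unfolding matrix_eq
proof
  fix x :: "real^'k"
  let ?d = "Y *v x - Z *v x"
  have "transpose M *v (M *v ?d) = 0"
    using arg_cong[OF assms, of "\<lambda>N. N *v x"]
    by (simp add: matrix_vector_mult_diff_distrib flip: matrix_vector_mul_assoc)
  then have "(M *v ?d) \<bullet> (M *v ?d) = 0"
    by (metis dot_lmul_matrix inner_zero_right transpose_matrix_vector inner_commute)
  then show "(M ** Y) *v x = (M ** Z) *v x"
    by (simp add: matrix_vector_mult_diff_distrib flip: matrix_vector_mul_assoc)
qed

lemma gram_projection:
  fixes M :: "real^'n^'m"
  obtains P where "M ** P ** transpose M ** M = M"
    and "transpose (M ** P ** transpose M) = M ** P ** transpose M"
proof -
  let ?N = "transpose M ** M"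
  obtain P where P: "?N ** P ** ?N = ?N"
    using inner_inverse_exists by blast
  have P': "?N ** transpose P ** ?N = ?N"
    using arg_cong[OF P, of transpose] by (simp add: matrix_transpose_mul matrix_mul_assoc)
  have 1: "M ** (P ** ?N) = M" 
    using gram_cancel[of M "P ** ?N" "mat 1"] P by (simp add: matrix_mul_assoc)
  have 2: "M ** (transpose P ** ?N) = M" 
    using gram_cancel[of M "transpose P ** ?N" "mat 1"] P' by (simp add: matrix_mul_assoc)
  let ?E = "M ** P ** transpose M"
  have "transpose ?E ** ?E = M ** (transpose P ** ?N) ** P ** transpose M"
    by (simp add: matrix_transpose_mul matrix_mul_assoc)
  then have E: "transpose ?E ** ?E = ?E" by (simp only: 2)
  have "transpose (transpose ?E ** ?E) = transpose ?E ** ?E"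
    by (simp add: matrix_transpose_mul)
  then have "transpose ?E = ?E" by (simp only: E)
  with 1 that show ?thesis by (simp add: matrix_mul_assoc)
qed

lemma is_pinv_exists:
  fixes M :: "real^'n^'m"
  shows "\<exists>G. is_pinv M G"
proof -
  let ?T = "transpose M"
  obtain P where P: "M ** P ** ?T ** M = M"
      "transpose (M ** P ** ?T) = M ** P ** ?T"
    using gram_projection by blast
  obtain P' where P': "?T ** P' ** M ** ?T = ?T"
      "transpose (?T ** P' ** M) = ?T ** P' ** M"
    using gram_projection[of ?T] by auto
  let ?F = "?T ** P' ** M"
  have MF: "M ** ?F = M"
    using arg_cong[OF P'(1), of transpose] P'(2)
    by (simp add: matrix_transpose_mul)
  have FF: "?F ** ?F = ?F"
    using MF by (metis matrix_mul_assoc)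
  let ?G = "?F ** P ** ?T"
  have MG: "M ** ?G = M ** P ** ?T" using MF by (metis matrix_mul_assoc)
  have GM: "?G ** M = ?F" using P(1) by (metis matrix_mul_assoc)
  have "?G ** M ** ?G = ?G" unfolding GM using FF by (metis matrix_mul_assoc)
  moreover have "M ** ?G ** M = M" unfolding MG by (rule P(1))
  ultimately have "is_pinv M ?G"
    unfolding is_pinv_def using GM MG P(2) P'(2) by simp
  then show ?thesis by blast
qed

lemma is_pinv_pinv: "is_pinv M (pinv M)"
  unfolding pinv_def
  using is_pinv_exists is_pinv_unique by (metis theI')

definition R_of :: "real^'m^'n \<Rightarrow> real^'m^'m \<Rightarrow> real^'n^'n \<Rightarrow> real^'m^'m" where
  "R_of B R X = R + transpose B ** X ** B"

definition S_of :: "real^'n^'n \<Rightarrow> real^'m^'n \<Rightarrow> real^'m^'n \<Rightarrow> real^'n^'n \<Rightarrow> real^'m^'n" where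
  "S_of A B S X = transpose A ** X ** B + S"

definition K_of :: "real^'n^'n \<Rightarrow> real^'m^'n \<Rightarrow> real^'m^'m \<Rightarrow> real^'m^'n \<Rightarrow> real^'n^'n \<Rightarrow> real^'n^'m" where
  "K_of A B R S X = pinv (R_of B R X) ** transpose (S_of A B S X)"

definition A_of :: "real^'n^'n \<Rightarrow> real^'m^'n \<Rightarrow> real^'m^'m \<Rightarrow> real^'m^'n \<Rightarrow> real^'n^'n \<Rightarrow> real^'n^'n" where
  "A_of A B R S X = A - B ** K_of A B R S X"

definition G_of :: "real^'m^'n \<Rightarrow> real^'m^'m \<Rightarrow> real^'n^'n \<Rightarrow> real^'m^'m" where
  "G_of B R X = mat 1 - pinv (R_of B R X) ** R_of B R X"

definition CGDARE ::
  "real^'n^'n \<Rightarrow> real^'m^'n \<Rightarrow> real^'n^'n \<Rightarrow> real^'m^'m \<Rightarrow> real^'m^'n \<Rightarrow> real^'n^'n \<Rightarrow> bool" where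
  "CGDARE A B Q R S X \<longleftrightarrow>
     transpose X = X \<and>
     X = transpose A ** X ** A
         - (transpose A ** X ** B + S) ** pinv (R + transpose B ** X ** B)
             ** (transpose B ** X ** A + transpose S)
         + Q \<and>
     mker (R + transpose B ** X ** B) \<subseteq> mker (transpose A ** X ** B + S)"

(* The image of the block row [H, F H, ..., F^(n-1) H], n the state dimension:
   the block column multiplying it has the n blocks w 0, ..., w (n - 1). *)
definition reachable_pair :: "real^'n^'n \<Rightarrow> real^'m^'n \<Rightarrow> (real^'n) set" where
  "reachable_pair F H =
     range (\<lambda>w :: nat \<Rightarrow> real^'m. \<Sum>k<CARD('n). (mpow F k ** H) *v w k)"

definition output_nulling ::
  "real^'n^'n \<Rightarrow> real^'m^'n \<Rightarrow> real^'n^'p \<Rightarrow> real^'m^'p \<Rightarrow> (real^'n) set \<Rightarrow> bool" where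
  "output_nulling A B C D V \<longleftrightarrow>
     subspace V \<and>
     (\<lambda>x. (A *v x, C *v x)) ` V \<subseteq> V \<times> {0} + range (\<lambda>u. (B *v u, D *v u))"

definition reachable_on ::
  "real^'n^'n \<Rightarrow> real^'m^'n \<Rightarrow> real^'n^'p \<Rightarrow> real^'m^'p \<Rightarrow> (real^'n) set \<Rightarrow> (real^'n) set" where
  "reachable_on A B C D V =
     {\<xi>. \<exists>(N :: nat) (u :: nat \<Rightarrow> real^'m) (x :: nat \<Rightarrow> real^'n).
           x 0 = 0 \<and>
           (\<forall>t<N. x (Suc t) = A *v x t + B *v u t) \<and>
           (\<forall>t\<le>N. x t \<in> V) \<and>
           (\<forall>t<N. C *v x t + D *v u t = 0) \<and>
           x N = \<xi>}"

end

theory Submission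
  imports Defs
begin

text \<open>
  Completing the square in the Riccati equation gives, for \<open>y = A x + B u\<close>,
  the identity \<open>y\<^sup>T X y + |C x + D u|\<^sup>2 = x\<^sup>T X x + (u + K x)\<^sup>T R\<^sub>X (u + K x)\<close> with \<open>K = K\<^sub>X\<close>.
  The matrix \<open>X\<close> may be indefinite, so vanishing of the right-hand side alone says nothing about
  the two terms on the left. But adding a vector of \<open>ker X \<times> ker R\<^sub>X\<close> does not change the right-hand
  side, and if its image \<open>w\<close> had \<open>X w \<noteq> 0\<close>, then the image of a negative definite subspace
  of maximal dimension could be enlarged, by a small perturbation of \<open>w\<close>, to a larger negative
  definite one. Hence \<open>A\<^sub>X\<close> and \<open>B\<close> map \<open>ker X\<close> and \<open>ker R\<^sub>X\<close> into \<open>ker X\<close> with zero output. Conversely, an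
  input that keeps the state in \<open>ker X\<close> and the output at zero is \<open>u = - K x + v\<close> with
  \<open>R\<^sub>X v = 0\<close>, that is, \<open>v = G\<^sub>X v\<close>.
\<close>

text \<open>This rule turns \<open>transpose M *v x\<close> into \<open>x v* M\<close>, a form to
  which \<open>inner_matrix_transpose\<close> and the associativity rewriting below do not
  apply.\<close>

declare transpose_matrix_vector [simp del]

lemma transpose_add:
  fixes M N :: "real^'n^'m"
  shows "transpose (M + N) = transpose M + transpose N"
  by (simp add: transpose_def vec_eq_iff)

lemma inner_matrix_transpose:
  fixes M :: "real^'n^'m"
  shows "x \<bullet> (transpose M *v y) = (M *v x) \<bullet> y"
  by (metis dot_lmul_matrix inner_commute transpose_matrix_vector)

lemma matrix_vector_mult_uminus_right:
  fixes M :: "real^'n^'m"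
  shows "M *v (- x) = - (M *v x)"
  by (metis add.inverse_unique add.right_inverse matrix_vector_mult_0_right matrix_vector_right_distrib)

section \<open>Negative definite subspaces of a symmetric form\<close>

definition negdef_on :: "real^'n^'n \<Rightarrow> (real^'n) set \<Rightarrow> bool" where
  "negdef_on X N \<longleftrightarrow> subspace N \<and> (\<forall>v\<in>N. v \<noteq> 0 \<longrightarrow> v \<bullet> (X *v v) < 0)"

lemma negdef_on_max_dim:
  fixes X :: "real^'n^'n"
  obtains N where "negdef_on X N" and "\<And>M. negdef_on X M \<Longrightarrow> dim M \<le> dim N"
proof -
  have "negdef_on X {0}"
    by (simp add: negdef_on_def subspace_def)
  then obtain N where "negdef_on X N" "\<forall>M. negdef_on X M \<longrightarrow> dim M \<le> dim N"
    using ex_has_greatest_nat[of "negdef_on X" "{0}" dim "Suc DIM(real^'n)"]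
      dim_subset_UNIV[where 'a = "real^'n"]
    by (metis le_imp_less_Suc less_imp_le)
  then show ?thesis
    using that by blast
qed

text \<open>The form attains its maximum on the compact unit sphere of \<open>N\<close>. That
  maximum is negative, and homogeneity carries the bound to all of \<open>N\<close>.\<close>

lemma negdef_on_uniform:
  fixes X :: "real^'n^'n"
  assumes N: "negdef_on X N"
  obtains a where "a > 0" and "\<And>v. v \<in> N \<Longrightarrow> v \<bullet> (X *v v) \<le> - a * (norm v)\<^sup>2"
proof (cases "N \<subseteq> {0}")
  case True
  then show ?thesis by (intro that[of 1]) auto
next
  case False
  then obtain v0 where v0: "v0 \<in> N" "v0 \<noteq> 0" by auto
  have sub: "subspace N" using N by (simp add: negdef_on_def)
  let ?K = "N \<inter> sphere 0 1"
  have unit: "v /\<^sub>R norm v \<in> ?K" if "v \<in> N" "v \<noteq> 0" for v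
    using that sub by (simp add: subspace_scale)
  have "compact ?K"
    using sub by (intro closed_Int_compact closed_subspace) auto
  moreover have "?K \<noteq> {}"
    using unit[OF v0] by blast
  moreover have "continuous_on ?K (\<lambda>v. v \<bullet> (X *v v))"
    by (intro continuous_intros linear_continuous_on matrix_vector_mul_bounded_linear)
  ultimately obtain s where s: "s \<in> ?K" "\<And>v. v \<in> ?K \<Longrightarrow> v \<bullet> (X *v v) \<le> s \<bullet> (X *v s)"
    using continuous_attains_sup[of ?K "\<lambda>v. v \<bullet> (X *v v)"] by blast
  show ?thesis
  proof (rule that[of "- (s \<bullet> (X *v s))"])
    show "- (s \<bullet> (X *v s)) > 0"
      using N s(1) by (auto simp: negdef_on_def)
    fix v assume v: "v \<in> N"
    show "v \<bullet> (X *v v) \<le> - (- (s \<bullet> (X *v s))) * (norm v)\<^sup>2"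
    proof (cases "v = 0")
      case False
      have "(v /\<^sub>R norm v) \<bullet> (X *v (v /\<^sub>R norm v)) = (v \<bullet> (X *v v)) / (norm v)\<^sup>2"
        by (simp only: matrix_vector_mult_scaleR inner_scaleR_left inner_scaleR_right)
          (simp add: power2_eq_square divide_inverse)
      then have "(v \<bullet> (X *v v)) / (norm v)\<^sup>2 \<le> s \<bullet> (X *v s)"
        using s(2)[OF unit[OF v False]] by simp
      then show ?thesis using False by (simp add: pos_divide_le_eq)
    qed simp
  qed
qed

text \<open>If \<open>z = X *v w\<close> were nonzero, moving \<open>w\<close> to
  \<open>w - d *\<^sub>R z\<close> would lower the form to first order in \<open>d\<close>, while
  the errors are of second order. So \<open>F\<close> on a maximal negative definite
  \<open>N\<close>, together with the moved \<open>w\<close>, would span a negative definite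
  subspace of dimension \<open>dim N + 1\<close>.\<close>

lemma negdef_perturbation:
  fixes X F :: "real^'n^'n" and w :: "real^'n"
  assumes sym: "transpose X = X"
    and le: "\<And>v c. (F *v v + c *\<^sub>R w) \<bullet> (X *v (F *v v + c *\<^sub>R w)) \<le> v \<bullet> (X *v v)"
  shows "X *v w = 0"
proof (rule ccontr)
  define z where "z = X *v w"
  assume "X *v w \<noteq> 0"
  then have z: "z \<noteq> 0" by (simp add: z_def)
  obtain N where N: "negdef_on X N" and max: "\<And>M. negdef_on X M \<Longrightarrow> dim M \<le> dim N"
    using negdef_on_max_dim by blast
  have subN: "subspace N" using N by (simp add: negdef_on_def)
  obtain a where a: "a > 0" "\<And>v. v \<in> N \<Longrightarrow> v \<bullet> (X *v v) \<le> - a * (norm v)\<^sup>2"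
    using negdef_on_uniform[OF N] by metis
  have Xsym: "x \<bullet> (X *v y) = y \<bullet> (X *v x)" for x y
    using inner_matrix_transpose[of x X y] sym by (simp add: inner_commute)
  have quadratic: "(y - e *\<^sub>R z) \<bullet> (X *v (y - e *\<^sub>R z)) =
      y \<bullet> (X *v y) - 2 * e * (y \<bullet> (X *v z)) + e\<^sup>2 * (z \<bullet> (X *v z))" for y e
    using Xsym[of z y]
    by (simp add: matrix_vector_mult_diff_distrib matrix_vector_mult_scaleR
        inner_diff_left inner_diff_right power2_eq_square right_diff_distrib)
  \<comment> \<open>\<open>g\<close> is the first-order gain, \<open>b\<close> controls the cross
    term between \<open>F *v v\<close> and \<open>z\<close>, and \<open>k\<close> the term quadratic
    in \<open>d\<close>.\<close>
  define g b k where "g = z \<bullet> z" and "b = norm (transpose F *v (X *v z))"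
    and "k = \<bar>z \<bullet> (X *v z)\<bar>"
  \<comment> \<open>Small enough that \<open>d * (b\<^sup>2 / a + k) < g\<close>; the summand 1
    makes the inequality strict and the denominator positive.\<close>
  define d where "d = g / (b\<^sup>2 / a + k + 1)"
  have g: "g > 0" using z by (simp add: g_def)
  have den: "b\<^sup>2 / a + k \<ge> 0" using a by (simp add: k_def)
  have d: "d > 0" using g den by (simp add: d_def)
  have dg: "d * (b\<^sup>2 / a + k) < g"
    using g den mult_strict_left_mono[of "b\<^sup>2 / a + k" "b\<^sup>2 / a + k + 1" g]
    by (simp add: d_def pos_divide_less_eq)
  define T where "T = (\<lambda>p :: (real^'n) \<times> real. F *v fst p + snd p *\<^sub>R (w - d *\<^sub>R z))"
  have linT: "linear T"
    unfolding T_def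
    by (rule linearI)
      (simp_all add: matrix_vector_right_distrib matrix_vector_mult_scaleR algebra_simps)
  have neg: "T (v, c) \<bullet> (X *v T (v, c)) < 0" if v: "v \<in> N" and nz: "(v, c) \<noteq> 0" for v c
  proof -
    let ?y = "F *v v + c *\<^sub>R w"
    have "T (v, c) = ?y - (c * d) *\<^sub>R z"
      by (simp add: T_def algebra_simps)
    then have "T (v, c) \<bullet> (X *v T (v, c)) =
        ?y \<bullet> (X *v ?y) - 2 * (c * d) * (?y \<bullet> (X *v z)) + (c * d)\<^sup>2 * (z \<bullet> (X *v z))"
      by (simp only: quadratic)
    \<comment> \<open>The gain appears here: by symmetry of \<open>X\<close>, pairing
      \<open>w\<close> with \<open>X *v z\<close> gives \<open>z\<close> paired with itself, which
      is \<open>g\<close>.\<close>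
    also have "?y \<bullet> (X *v z) = v \<bullet> (transpose F *v (X *v z)) + c * g"
      using Xsym[of w z] by (simp add: inner_add_left inner_matrix_transpose g_def flip: z_def)
    also have "2 * (c * d) * (v \<bullet> (transpose F *v (X *v z)) + c * g)
        = 2 * (c * d * (v \<bullet> (transpose F *v (X *v z)))) + 2 * (c * d) * (c * g)"
      by (simp add: distrib_left)
    finally have "T (v, c) \<bullet> (X *v T (v, c)) = ?y \<bullet> (X *v ?y)
        - (2 * (c * d * (v \<bullet> (transpose F *v (X *v z)))) + 2 * (c * d) * (c * g))
        + (c * d)\<^sup>2 * (z \<bullet> (X *v z))" .
    moreover have "?y \<bullet> (X *v ?y) \<le> - a * (norm v)\<^sup>2"
      using le[of v c] a(2)[OF v] by linarith
    moreover have "- (c * d * (v \<bullet> (transpose F *v (X *v z)))) \<le> \<bar>c\<bar> * d * (norm v * b)"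
    proof -
      have "- (c * d * (v \<bullet> (transpose F *v (X *v z))))
          \<le> \<bar>c * d\<bar> * \<bar>v \<bullet> (transpose F *v (X *v z))\<bar>"
        by (metis abs_ge_minus_self abs_mult)
      also have "\<dots> \<le> \<bar>c * d\<bar> * (norm v * b)"
        unfolding b_def by (intro mult_left_mono Cauchy_Schwarz_ineq2) auto
      finally show ?thesis using d by (simp add: abs_mult)
    qed
    moreover have "(c * d)\<^sup>2 * (z \<bullet> (X *v z)) \<le> (c * d)\<^sup>2 * k"
      unfolding k_def by (intro mult_left_mono) auto
    ultimately have bound: "T (v, c) \<bullet> (X *v T (v, c)) \<le>
        - a * (norm v)\<^sup>2 + 2 * (\<bar>c\<bar> * d * (norm v * b)) - 2 * (c * d) * (c * g) + (c * d)\<^sup>2 * k"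
      by linarith
    show ?thesis
    proof (cases "c = 0")
      case True
      then have "norm v > 0" using nz by (simp add: zero_prod_def)
      then have "- a * (norm v)\<^sup>2 < 0" using a(1) by simp
      then show ?thesis using bound True by simp
    next
      case False
      \<comment> \<open>Completing the square in \<open>norm v\<close> absorbs the cross term into
        the negative term from \<open>N\<close>, at a cost of second order in
        \<open>d\<close>.\<close>
      have "(a * norm v - \<bar>c\<bar> * d * b)\<^sup>2 =
          a * (a * (norm v)\<^sup>2 - 2 * (\<bar>c\<bar> * d * (norm v * b))) + (\<bar>c\<bar> * d * b)\<^sup>2"
        by (simp add: power2_eq_square algebra_simps)
      then have "(a * norm v - \<bar>c\<bar> * d * b)\<^sup>2 / a =
          a * (norm v)\<^sup>2 - 2 * (\<bar>c\<bar> * d * (norm v * b)) + c\<^sup>2 * d\<^sup>2 * (b\<^sup>2 / a)"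
        using a(1) by (simp add: add_divide_distrib power_mult_distrib)
      moreover have "0 \<le> (a * norm v - \<bar>c\<bar> * d * b)\<^sup>2 / a" using a(1) by simp
      ultimately have "T (v, c) \<bullet> (X *v T (v, c)) \<le> (c\<^sup>2 * d) * (d * (b\<^sup>2 / a + k) - 2 * g)"
        using bound by (simp add: power2_eq_square algebra_simps)
      also have "\<dots> < 0"
        using False d dg g by (intro mult_pos_neg) auto
      finally show ?thesis .
    qed
  qed
  let ?P = "N \<times> (UNIV :: real set)"
  have subP: "subspace ?P" using subN by (intro subspace_Times) auto
  have neg': "T p \<bullet> (X *v T p) < 0" if "p \<in> ?P" "p \<noteq> 0" for p
    using neg[of "fst p" "snd p"] that by (auto simp: mem_Times_iff)
  \<comment> \<open>A vector sent to 0 would give the form the value 0, so strict negativity makes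
    \<open>T\<close> injective and the dimension goes up by one.\<close>
  have ker: "p = 0" if "p \<in> ?P" "T p = 0" for p
    using neg'[OF that(1)] that(2) by auto
  have "span ?P = ?P" using subP by (simp only: span_eq_iff)
  moreover have "inj_on T ?P"
  proof (rule inj_onI)
    fix p q assume "p \<in> ?P" "q \<in> ?P" "T p = T q"
    then have "p - q = 0"
      by (intro ker subspace_diff[OF subP]) (simp_all only: linear_diff[OF linT] diff_self)
    then show "p = q" by simp
  qed
  ultimately have "inj_on T (span ?P)" by (simp only:)
  then have "dim (T ` ?P) = dim ?P"
    by (rule dim_image_eq[OF linT])
  also have "\<dots> = dim N + 1"
    using dim_Times[OF subN subspace_UNIV[where 'a = real]] by simp
  finally have "dim (T ` ?P) = dim N + 1" .
  moreover have "negdef_on X (T ` ?P)"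
    unfolding negdef_on_def
  proof (intro conjI ballI impI)
    show "subspace (T ` ?P)" by (rule linear_subspace_image[OF linT subP])
    fix y assume "y \<in> T ` ?P" "y \<noteq> 0"
    then obtain p where p: "p \<in> ?P" "y = T p" by blast
    with \<open>y \<noteq> 0\<close> have "p \<noteq> 0" using linear_0[OF linT] by metis
    then show "y \<bullet> (X *v y) < 0" using neg'[OF p(1)] p(2) by simp
  qed
  ultimately show False using max[of "T ` ?P"] by simp
qed

text \<open>Transposition preserves the first two Penrose equations and exchanges the two symmetry
  conditions, so uniqueness applies.\<close>

lemma pinv_transpose:
  fixes M :: "real^'n^'m"
  shows "pinv (transpose M) = transpose (pinv M)"
proof -
  have "is_pinv (transpose M) (transpose (pinv M))"
    using is_pinv_pinv[of M] unfolding is_pinv_def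
    by (metis matrix_transpose_mul matrix_mul_assoc)
  then show ?thesis
    using is_pinv_unique is_pinv_pinv by blast
qed

section \<open>Krylov subspaces and their stabilisation\<close>

definition krylov :: "real^'n^'n \<Rightarrow> real^'m^'n \<Rightarrow> nat \<Rightarrow> (real^'n) set" where
  "krylov F H N = range (\<lambda>w :: nat \<Rightarrow> real^'m. \<Sum>k<N. (mpow F k ** H) *v w k)"

lemma krylov_0: "krylov F H 0 = {0}"
  by (auto simp: krylov_def)

text \<open>Horner's scheme: \<open>F\<close> is factored out of all terms but the first. In terms
  of trajectories, \<open>w 0\<close> is the input applied last.\<close>

lemma sum_mpow_Suc:
  fixes F :: "real^'n^'n" and H :: "real^'m^'n"
  shows "(\<Sum>k<Suc N. (mpow F k ** H) *v w k) =
     F *v (\<Sum>k<N. (mpow F k ** H) *v w (Suc k)) + H *v w 0"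
  unfolding sum.lessThan_Suc_shift linear_sum[OF matrix_vector_mul_linear]
  by (simp add: matrix_vector_mul_assoc matrix_mul_assoc add.commute)

lemma krylov_Suc: "krylov F H (Suc N) = {F *v x + H *v u | x u. x \<in> krylov F H N}"
proof (intro equalityI subsetI)
  fix y assume "y \<in> krylov F H (Suc N)"
  then obtain w where "y = F *v (\<Sum>k<N. (mpow F k ** H) *v w (Suc k)) + H *v w 0"
    unfolding krylov_def sum_mpow_Suc by blast
  moreover have "(\<Sum>k<N. (mpow F k ** H) *v w (Suc k)) \<in> krylov F H N"
    unfolding krylov_def by (rule range_eqI[where x = "\<lambda>k. w (Suc k)"]) simp
  ultimately show "y \<in> {F *v x + H *v u | x u. x \<in> krylov F H N}" by blast
next
  fix y assume "y \<in> {F *v x + H *v u | x u. x \<in> krylov F H N}"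
  then obtain w u where y: "y = F *v (\<Sum>k<N. (mpow F k ** H) *v w k) + H *v u"
    by (auto simp: krylov_def)
  have "y = (\<Sum>k<Suc N. (mpow F k ** H) *v case_nat u w k)"
    unfolding sum_mpow_Suc y by simp
  then show "y \<in> krylov F H (Suc N)"
    unfolding krylov_def by (rule range_eqI[where x = "case_nat u w"])
qed

lemma subspace_krylov: "subspace (krylov F H N)"
proof -
  have "\<exists>w''. (\<Sum>k<N. (mpow F k ** H) *v w k) + (\<Sum>k<N. (mpow F k ** H) *v w' k)
      = (\<Sum>k<N. (mpow F k ** H) *v w'' k)" for w w'
    by (rule exI[of _ "\<lambda>k. w k + w' k"])
      (simp add: matrix_vector_right_distrib sum.distrib)
  moreover have "\<exists>w'. c *\<^sub>R (\<Sum>k<N. (mpow F k ** H) *v w k) = (\<Sum>k<N. (mpow F k ** H) *v w' k)" for c w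
    by (rule exI[of _ "\<lambda>k. c *\<^sub>R w k"])
      (simp add: matrix_vector_mult_scaleR scaleR_sum_right)
  moreover have "\<exists>w. 0 = (\<Sum>k<N. (mpow F k ** H) *v w k)"
    by (rule exI[of _ "\<lambda>k. 0"]) simp
  ultimately show ?thesis
    unfolding subspace_def krylov_def by fastforce
qed

lemma krylov_mono:
  assumes "M \<le> N"
  shows "krylov F H M \<subseteq> krylov F H N"
proof -
  have "krylov F H N \<subseteq> krylov F H (Suc N)" for N
  proof (induction N)
    case 0
    show ?case by (simp add: krylov_0 subspace_0 subspace_krylov)
  next
    case (Suc N)
    then show ?case unfolding krylov_Suc[of F H "Suc N"] by (subst krylov_Suc) blast
  qed
  then show ?thesis
    using assms by (rule lift_Suc_mono_le[where f = "krylov F H"])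
qed

text \<open>The increasing chain cannot grow strictly at each of its first
  \<open>CARD('n) + 1\<close> steps, and by \<open>krylov_Suc\<close> it is constant after the first
  step at which it does not grow.\<close>

lemma krylov_stable:
  fixes F :: "real^'n^'n" and H :: "real^'m^'n"
  shows "krylov F H N \<subseteq> krylov F H CARD('n)"
proof -
  have "\<exists>k\<le>CARD('n). krylov F H (Suc k) = krylov F H k"
  proof (rule ccontr)
    assume *: "\<not> ?thesis"
    \<comment> \<open>Each strict inclusion of subspaces raises the dimension, which would finally
      exceed that of the whole space.\<close>
    have "k \<le> Suc CARD('n) \<Longrightarrow> k \<le> dim (krylov F H k)" for k
    proof (induction k)
      case (Suc k)
      have "krylov F H k \<subset> krylov F H (Suc k)"
        using * Suc.prems krylov_mono[of k "Suc k" F H] by auto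
      then have "dim (krylov F H k) < dim (krylov F H (Suc k))"
        by (metis dim_psubset span_eq_iff subspace_krylov)
      then show ?case using Suc by simp
    qed simp
    then have "Suc CARD('n) \<le> dim (krylov F H (Suc CARD('n)))" by blast
    also have "\<dots> \<le> CARD('n)"
      using dim_subset_UNIV[of "krylov F H (Suc CARD('n))"] by simp
    finally show False by simp
  qed
  then obtain k where k: "k \<le> CARD('n)" "krylov F H (Suc k) = krylov F H k" by blast
  have "krylov F H (k + j) = krylov F H k" for j
    by (induction j) (use k in \<open>auto simp: krylov_Suc\<close>)
  then have "krylov F H N \<subseteq> krylov F H k"
    using krylov_mono[of N "k + N" F H] by simp
  also have "\<dots> \<subseteq> krylov F H CARD('n)"
    using k(1) by (rule krylov_mono)
  finally show ?thesis .
qed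

lemma reachable_pair_eq_krylov:
  fixes F :: "real^'n^'n"
  shows "reachable_pair F H = krylov F H CARD('n)"
  by (simp add: reachable_pair_def krylov_def)

section \<open>The Riccati equation and the invariance of ker X\<close>

context
  fixes A :: "real^'n^'n" and B :: "real^'m^'n"
    and C :: "real^'n^'p" and D :: "real^'m^'p"
    and Q :: "real^'n^'n" and S :: "real^'m^'n" and R :: "real^'m^'m"
    and X :: "real^'n^'n"
  assumes Q: "Q = transpose C ** C"
    and S: "S = transpose C ** D"
    and R: "R = transpose D ** D"
    and dare: "CGDARE A B Q R S X"
begin

abbreviation (input) "RX \<equiv> R_of B R X"
abbreviation (input) "SX \<equiv> S_of A B S X"
abbreviation (input) "KX \<equiv> K_of A B R S X"
abbreviation (input) "AX \<equiv> A_of A B R S X"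
abbreviation (input) "GX \<equiv> G_of B R X"

lemma X_sym: "transpose X = X"
  using dare by (simp add: CGDARE_def)

lemma RX_sym: "transpose RX = RX"
  by (simp add: R_of_def R matrix_transpose_mul X_sym transpose_add matrix_mul_assoc)

lemma transpose_SX: "transpose SX = transpose B ** X ** A + transpose S"
  by (simp add: S_of_def matrix_transpose_mul X_sym transpose_add matrix_mul_assoc)

text \<open>Together with \<open>GX_ker\<close> this shows that the range of \<open>GX\<close> is
  the kernel of \<open>RX\<close>.\<close>

lemma RX_GX: "RX *v (GX *v u) = 0"
proof -
  have "RX ** pinv RX ** RX = RX"
    using is_pinv_pinv[of RX] by (simp add: is_pinv_def)
  then show ?thesis
    by (simp add: G_of_def matrix_vector_mult_diff_rdistrib matrix_vector_mult_diff_distrib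
        matrix_vector_mul_assoc matrix_mul_assoc)
qed

lemma GX_ker: "RX *v u = 0 \<Longrightarrow> GX *v u = u"
  by (simp add: G_of_def matrix_vector_mult_diff_rdistrib flip: matrix_vector_mul_assoc)

text \<open>The kernel inclusion in \<open>CGDARE\<close> says that \<open>SX\<close> annihilates
  the range of \<open>GX\<close>, so \<open>SX ** pinv RX ** RX = SX\<close>. Transposing, with
  \<open>RX\<close> symmetric, gives the claim.\<close>

lemma RX_KX: "RX ** KX = transpose SX"
proof -
  have "mker RX \<subseteq> mker SX"
    using dare by (simp add: CGDARE_def R_of_def S_of_def)
  then have "SX *v (GX *v u) = 0" for u
    using RX_GX by (auto simp: mker_def)
  then have "SX ** pinv RX ** RX = SX"
    unfolding matrix_eq
    by (simp add: G_of_def matrix_vector_mult_diff_rdistrib matrix_vector_mult_diff_distrib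
        flip: matrix_vector_mul_assoc)
  then have "transpose SX = transpose (SX ** pinv RX ** RX)" by simp
  also have "\<dots> = RX ** KX"
    using pinv_transpose[of RX]
    by (simp add: K_of_def matrix_transpose_mul RX_sym matrix_mul_assoc)
  finally show ?thesis by simp
qed

text \<open>Both sides are expanded in \<open>x\<close> and \<open>u\<close>: the Riccati equation
  matches the terms in \<open>x\<close> alone, \<open>RX_KX\<close> the mixed terms, and the
  definition of \<open>RX\<close> those in \<open>u\<close> alone.\<close>

lemma dare_complete_square:
  fixes x :: "real^'n" and u :: "real^'m"
  defines "y \<equiv> A *v x + B *v u"
  shows "y \<bullet> (X *v y) + (C *v x + D *v u) \<bullet> (C *v x + D *v u)
    = x \<bullet> (X *v x) + (u + KX *v x) \<bullet> (RX *v (u + KX *v x))"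
proof -
  have RXs: "p \<bullet> (RX *v q) = q \<bullet> (RX *v p)" for p q
    using inner_matrix_transpose[of p RX q] RX_sym by (simp add: inner_commute)
  have Xs: "p \<bullet> (X *v q) = q \<bullet> (X *v p)" for p q
    using inner_matrix_transpose[of p X q] X_sym by (simp add: inner_commute)
  have "X = transpose A ** X ** A - SX ** KX + Q"
    using dare unfolding CGDARE_def
    by (simp add: K_of_def R_of_def matrix_mul_assoc transpose_SX flip: S_of_def)
  then have "x \<bullet> (X *v x) = x \<bullet> ((transpose A ** X ** A - SX ** KX + Q) *v x)"
    by simp
  also have "\<dots> = (A *v x) \<bullet> (X *v (A *v x)) - x \<bullet> (SX *v (KX *v x)) + (C *v x) \<bullet> (C *v x)"
    by (simp add: Q matrix_vector_mult_diff_rdistrib matrix_vector_mult_add_rdistrib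
        inner_add_right inner_diff_right inner_matrix_transpose flip: matrix_vector_mul_assoc)
  also have "x \<bullet> (SX *v (KX *v x)) = (KX *v x) \<bullet> (RX *v (KX *v x))"
    using inner_matrix_transpose[of "KX *v x" SX x]
    by (simp add: inner_commute matrix_vector_mul_assoc flip: RX_KX)
  finally have 1: "x \<bullet> (X *v x) = (A *v x) \<bullet> (X *v (A *v x))
      - (KX *v x) \<bullet> (RX *v (KX *v x)) + (C *v x) \<bullet> (C *v x)" .
  have "u \<bullet> (RX *v (KX *v x)) = u \<bullet> (transpose SX *v x)"
    by (simp add: matrix_vector_mul_assoc RX_KX)
  also have "\<dots> = (B *v u) \<bullet> (X *v (A *v x)) + (D *v u) \<bullet> (C *v x)"
    unfolding transpose_SX
    by (simp add: S matrix_transpose_mul matrix_vector_mult_add_rdistrib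
        inner_add_right inner_matrix_transpose flip: matrix_vector_mul_assoc)
  finally have 2: "u \<bullet> (RX *v (KX *v x)) = (B *v u) \<bullet> (X *v (A *v x)) + (D *v u) \<bullet> (C *v x)" .
  have 3: "u \<bullet> (RX *v u) = (D *v u) \<bullet> (D *v u) + (B *v u) \<bullet> (X *v (B *v u))"
    by (simp add: R_of_def R matrix_vector_mult_add_rdistrib
        inner_add_right inner_matrix_transpose flip: matrix_vector_mul_assoc)
  show ?thesis
    unfolding y_def
    using 1 2 3 RXs[of "KX *v x" u] Xs[of "A *v x" "B *v u"]
    by (simp add: matrix_vector_right_distrib inner_add_left inner_add_right
        inner_commute[of "C *v x" "D *v u"])
qed

text \<open>Change of input: \<open>v\<close> is the part of the input left over after the feedback
  \<open>- KX *v x\<close>.\<close>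

lemma AX_step: "AX *v x + B *v v = A *v x + B *v (v - KX *v x)"
  by (simp add: A_of_def matrix_vector_mult_diff_rdistrib matrix_vector_mult_diff_distrib
      flip: matrix_vector_mul_assoc)

lemma kernel_step:
  assumes x: "X *v x = 0" and v: "RX *v v = 0"
  shows "X *v (AX *v x + B *v v) = 0" and "C *v x + D *v (v - KX *v x) = 0"
proof -
  let ?w = "AX *v x + B *v v"
  have Xs: "p \<bullet> (X *v q) = q \<bullet> (X *v p)" for p q
    using inner_matrix_transpose[of p X q] X_sym by (simp add: inner_commute)
  show w: "X *v ?w = 0"
  proof (rule negdef_perturbation[OF X_sym, of AX])
    fix p :: "real^'n" and c :: real
    let ?x = "p + c *\<^sub>R x" and ?v = "c *\<^sub>R v"
    \<comment> \<open>By linearity, the perturbed vector is the successor of the shifted state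
      \<open>?x\<close> under the feedback and the extra input \<open>?v\<close>.\<close>
    have eq: "AX *v p + c *\<^sub>R ?w = A *v ?x + B *v (?v - KX *v ?x)"
      by (subst AX_step[symmetric])
        (simp add: matrix_vector_right_distrib matrix_vector_mult_scaleR algebra_simps)
    \<comment> \<open>Since \<open>RX *v ?v = 0\<close>, the last term of the completed square
      vanishes; dropping the squared output leaves an inequality.\<close>
    have "(AX *v p + c *\<^sub>R ?w) \<bullet> (X *v (AX *v p + c *\<^sub>R ?w)) \<le> ?x \<bullet> (X *v ?x)"
      using dare_complete_square[of ?x "?v - KX *v ?x"]
        inner_ge_zero[of "C *v ?x + D *v (?v - KX *v ?x)"] v
      unfolding eq by (simp add: matrix_vector_mult_scaleR del: inner_ge_zero)
    also have "\<dots> = p \<bullet> (X *v p)"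
      by (simp add: matrix_vector_right_distrib matrix_vector_mult_scaleR x
          inner_add_left Xs[of x])
    finally show "(AX *v p + c *\<^sub>R ?w) \<bullet> (X *v (AX *v p + c *\<^sub>R ?w)) \<le> p \<bullet> (X *v p)" .
  qed
  \<comment> \<open>Now that the successor lies in the kernel of \<open>X\<close>, the completed
    square reduces to a vanishing squared output.\<close>
  show "C *v x + D *v (v - KX *v x) = 0"
    using dare_complete_square[of x "v - KX *v x"] w v x
    by (simp flip: AX_step)
qed

text \<open>The left-hand side is \<open>transpose D\<close> applied to the output plus
  \<open>transpose B ** X\<close> applied to the next state.\<close>

lemma kernel_input:
  assumes "C *v x + D *v u = 0" and "X *v (A *v x + B *v u) = 0"
  shows "RX *v (u + KX *v x) = 0"
proof -
  have "RX *v (u + KX *v x) = RX *v u + transpose SX *v x"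
    by (simp add: matrix_vector_right_distrib matrix_vector_mul_assoc RX_KX)
  also have "\<dots> = transpose D *v (C *v x + D *v u) + transpose B *v (X *v (A *v x + B *v u))"
    unfolding transpose_SX
    by (simp add: R_of_def R S matrix_transpose_mul matrix_vector_mult_add_rdistrib
        matrix_vector_right_distrib add_ac flip: matrix_vector_mul_assoc)
  finally show ?thesis using assms by simp
qed

text \<open>By \<open>kernel_step\<close> with \<open>v = 0\<close>, the feedback keeps the state in
  the kernel with zero output; \<open>KX *v x\<close> is the witness in the range.\<close>

lemma kernel_output_nulling: "output_nulling A B C D (mker X)"
proof -
  have "(A *v x, C *v x) \<in> mker X \<times> {0} + range (\<lambda>u. (B *v u, D *v u))"
    if "x \<in> mker X" for x
  proof (rule set_plus_intro[where b = "(B *v (KX *v x), D *v (KX *v x))" and a = "(AX *v x, 0)",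
        THEN back_subst[where P = "\<lambda>p. p \<in> _"]])
    show "(AX *v x, 0) \<in> mker X \<times> {0}"
      using kernel_step(1)[of x 0] that by (simp add: mker_def)
    show "(AX *v x, 0) + (B *v (KX *v x), D *v (KX *v x)) = (A *v x, C *v x)"
      using kernel_step(2)[of x 0] that AX_step[of x 0]
      by (simp add: mker_def matrix_vector_mult_uminus_right)
  qed simp
  moreover have "subspace (mker X)"
    by (auto simp: mker_def subspace_def matrix_vector_right_distrib matrix_vector_mult_scaleR)
  ultimately show ?thesis
    by (auto simp: output_nulling_def)
qed

section \<open>The two inclusions between the reachable subspaces\<close>

lemma reachable_on_kernel_le:
  "reachable_on A B C D (mker X) \<subseteq> krylov AX (B ** GX) CARD('n)"
proof
  fix \<xi> assume "\<xi> \<in> reachable_on A B C D (mker X)"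
  then obtain N u x where x0: "x 0 = 0" and xs: "\<And>t. t < N \<Longrightarrow> x (Suc t) = A *v x t + B *v u t"
    and xk: "\<And>t. t \<le> N \<Longrightarrow> X *v x t = 0" and out: "\<And>t. t < N \<Longrightarrow> C *v x t + D *v u t = 0"
    and xN: "x N = \<xi>"
    unfolding reachable_on_def mker_def by blast
  have "t \<le> N \<Longrightarrow> x t \<in> krylov AX (B ** GX) t" for t
  proof (induction t)
    case 0
    then show ?case by (simp add: x0 krylov_0)
  next
    case (Suc t)
    let ?v = "u t + KX *v x t"
    \<comment> \<open>As the next state is in the kernel of \<open>X\<close> and the output is zero,
      \<open>RX\<close> annihilates \<open>?v\<close>; hence this input enters through
      \<open>B ** GX\<close>.\<close>
    have "GX *v ?v = ?v"
      using Suc.prems out xs xk[of "Suc t"] by (intro GX_ker kernel_input) auto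
    then have "x (Suc t) = AX *v x t + (B ** GX) *v ?v"
      using Suc.prems xs AX_step[of "x t" ?v] by (simp flip: matrix_vector_mul_assoc)
    then show ?case using Suc by (auto simp: krylov_Suc)
  qed
  \<comment> \<open>The length \<open>N\<close> may exceed \<open>CARD('n)\<close>, hence the appeal
    to stabilisation.\<close>
  then show "\<xi> \<in> krylov AX (B ** GX) CARD('n)"
    using krylov_stable xN by blast
qed

lemma krylov_le_reachable_on_kernel:
  "krylov AX (B ** GX) N \<subseteq> reachable_on A B C D (mker X)"
proof
  fix \<xi> assume "\<xi> \<in> krylov AX (B ** GX) N"
  then show "\<xi> \<in> reachable_on A B C D (mker X)"
  proof (induction N arbitrary: \<xi>)
    case 0
    then show ?case
      by (auto simp: krylov_0 reachable_on_def mker_def intro!: exI[of _ 0] exI[of _ "\<lambda>_. 0"])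
  next
    case (Suc N)
    then obtain \<eta> g where \<eta>: "\<eta> \<in> reachable_on A B C D (mker X)"
      and \<xi>: "\<xi> = AX *v \<eta> + B *v (GX *v g)"
      by (auto simp: krylov_Suc simp flip: matrix_vector_mul_assoc)
    from \<eta> obtain M u x where x0: "x 0 = 0"
      and xs: "\<And>t. t < M \<Longrightarrow> x (Suc t) = A *v x t + B *v u t"
      and xk: "\<And>t. t \<le> M \<Longrightarrow> x t \<in> mker X"
      and out: "\<And>t. t < M \<Longrightarrow> C *v x t + D *v u t = 0" and xM: "x M = \<eta>"
      unfolding reachable_on_def by blast
    let ?u = "GX *v g - KX *v \<eta>"
    have "X *v \<eta> = 0" using xk[of M] xM by (simp add: mker_def)
    from kernel_step[OF this RX_GX[of g]]
    have "\<xi> \<in> mker X" and "C *v \<eta> + D *v ?u = 0"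
      by (simp_all add: mker_def \<xi>)
    moreover have "\<xi> = A *v \<eta> + B *v ?u" by (simp add: \<xi> AX_step)
    ultimately show ?case
      unfolding reachable_on_def using x0 xs xk out xM
      \<comment> \<open>The trajectory ending in \<open>\<eta>\<close> at time \<open>M\<close> is
        prolonged by one step; only the input at \<open>M\<close> and the state at
        \<open>Suc M\<close> are overwritten, so all earlier conditions persist.\<close>
      by (intro CollectI exI[of _ "Suc M"] exI[of _ "u(M := ?u)"] exI[of _ "x(Suc M := \<xi>)"])
        (auto simp: less_Suc_eq le_Suc_eq)
  qed
qed

end

theorem theorem4p2:
  fixes A :: "real^'n^'n" and B :: "real^'m^'n"
    and C :: "real^'n^'p" and D :: "real^'m^'p"
    and Q :: "real^'n^'n" and S :: "real^'m^'n" and R :: "real^'m^'m"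
    and X :: "real^'n^'n"
  assumes "Q = transpose C ** C"
    and "S = transpose C ** D"
    and "R = transpose D ** D"
    and "CGDARE A B Q R S X"
  shows "output_nulling A B C D (mker X) \<and>
         reachable_on A B C D (mker X)
           = reachable_pair (A_of A B R S X) (B ** G_of B R X)"
  unfolding reachable_pair_eq_krylov
  using kernel_output_nulling[OF assms] reachable_on_kernel_le[OF assms]
    krylov_le_reachable_on_kernel[OF assms] by blast

end
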